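(* Let $N>2$. For all $t\le N$ and all $h_t=(s_1,\dots,s_t)\in H_t$, $U_t(s_t)=e(V'_t(h_t))$.
   Context: Setting (vector-valued Markov decision process). Integers $N$ and $m\ge1$ are fixed. $S$ is a finite set of states; for each $s\in S$, $A_s$ is a nonempty compact set of actions; $A=\bigcup_{s\in S}A_s$. For $t=1,\dots,N-1$, $s\in S$, $a\in A_s$, $R_t(s,a)\in\mathbb{R}^m$ is a vector reward, with components continuous in $a\in A_s$; $p_t(j\mid s,a)$ is the probability of state $j\in S$ at epoch $t+1$ given action $a$ in state $s$ at epoch $t$, continuous in $a\in A_s$. $R_N(s)\in\mathbb{R}^m$ is the terminal reward. Histories and policies. For $t\le N$, $H_t=S^t$ is the set of histories $h_t=(s_1,\dots,s_t)$; $(h_t,j)=(s_1,\dots,s_t,j)$. For $t<N$, a $t$-decision rule is a map $d:H_t\to A$ with $d(s_1,\dots,s_t)\in A_{s_t}$; $D_t$ is the set of all $t$-decision rules, assumed compact (topology of pointwise convergence). A policy is $\pi=(d_1,\dots,d_{N-1})$ with $d_t\in D_t$; $P=D_1\times\cdots\times D_{N-1}$ is the set of all policies. Expected total rewards: $u_N^\pi(h_N)=R_N(s_N)$ and, for $t<N$, $h_t=(s_1,\dots,s_t)$, $$u_t^\pi(h_t)=R_t(s_t,d_t(h_t))+\sum_{j\in S}p_t(j\mid s_t,d_t(h_t))\,u_{t+1}^\pi(h_t,j).$$ Set $V'_t(h_t)=\{u_t^\pi(h_t):\pi\in P\}$ for $t\le N$. Order on $\mathbb{R}^m$: $x\ge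 y$ iff $x_i\ge y_i$ for all $i$. For $X\subseteq\mathbb{R}^m$, $e(X)=\{x\in X:\forall y\in X,\ y\ge x\Rightarrow y=x\}$. White's equations: define by backward recursion, for $s\in S$, $U_N(s)=\{R_N(s)\}$ and, for $t<N$, $$U_t(s)=e\Bigl(\bigl\{R_t(s,a)+\textstyle\sum_{j\in S}p_t(j\mid s,a)v_j : a\in A_s,\ v_j\in U_{t+1}(j)\ \text{for all } j\in S\bigr\}\Bigr).$$ *)

theory Defs
  imports "HOL-Analysis.Analysis"
begin

text \<open>
  A history \<open>(s\<^sub>1, \<dots>, s\<^sub>t)\<close> is the list \<open>[s\<^sub>1, \<dots>, s\<^sub>t]\<close>, so that \<open>s\<^sub>t\<close> is \<open>last h\<close> and
  \<open>(h, j)\<close> is \<open>h @ [j]\<close>.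
\<close>

definition histories :: "'s set \<Rightarrow> nat \<Rightarrow> 's list set" where
  "histories S t = {h. set h \<subseteq> S \<and> length h = t}"

text \<open>
  Decision rules are extensional functions on \<open>histories S t\<close>; on these, the topology of the
  function type (the product topology) is that of pointwise convergence on \<open>histories S t\<close>.
\<close>

definition decision_rules :: "'s set \<Rightarrow> ('s \<Rightarrow> 'a set) \<Rightarrow> nat \<Rightarrow> ('s list \<Rightarrow> 'a) set" where
  "decision_rules S A t = (\<Pi>\<^sub>E h \<in> histories S t. A (last h))"

definition policies :: "nat \<Rightarrow> 's set \<Rightarrow> ('s \<Rightarrow> 'a set) \<Rightarrow> (nat \<Rightarrow> 's list \<Rightarrow> 'a) set" where
  "policies N S A = (\<Pi>\<^sub>E t \<in> {1..<N}. decision_rules S A t)"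

text \<open>
  In the two backward recursions below, \<open>p t j s a\<close> stands for \<open>p\<^sub>t(j | s, a)\<close> and \<open>R\<^sub>N\<close> is the
  separate argument \<open>RN\<close>. Only the epochs \<open>1 \<le> t \<le> N\<close> are meaningful; the \<open>else\<close> branch
  is the terminal epoch \<open>t = N\<close>.
\<close>

function total_reward ::
  "nat \<Rightarrow> 's set \<Rightarrow> (nat \<Rightarrow> 's \<Rightarrow> 'a \<Rightarrow> real ^ 'm) \<Rightarrow> ('s \<Rightarrow> real ^ 'm) \<Rightarrow>
   (nat \<Rightarrow> 's \<Rightarrow> 's \<Rightarrow> 'a \<Rightarrow> real) \<Rightarrow> (nat \<Rightarrow> 's list \<Rightarrow> 'a) \<Rightarrow> nat \<Rightarrow> 's list \<Rightarrow> real ^ 'm"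
where
  "total_reward N S R RN p \<pi> t h =
     (if t < N
      then R t (last h) (\<pi> t h)
           + (\<Sum>j\<in>S. p t j (last h) (\<pi> t h) *\<^sub>R total_reward N S R RN p \<pi> (Suc t) (h @ [j]))
      else RN (last h))"
  by auto
termination
  by (relation "Wellfounded.measure (\<lambda>(N, S, R, RN, p, \<pi>, t, h). N - t)") auto

definition attainable_rewards ::
  "nat \<Rightarrow> 's set \<Rightarrow> ('s \<Rightarrow> 'a set) \<Rightarrow> (nat \<Rightarrow> 's \<Rightarrow> 'a \<Rightarrow> real ^ 'm) \<Rightarrow> ('s \<Rightarrow> real ^ 'm) \<Rightarrow>
   (nat \<Rightarrow> 's \<Rightarrow> 's \<Rightarrow> 'a \<Rightarrow> real) \<Rightarrow> nat \<Rightarrow> 's list \<Rightarrow> (real ^ 'm) set"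
where
  "attainable_rewards N S A R RN p t h =
     {total_reward N S R RN p \<pi> t h | \<pi>. \<pi> \<in> policies N S A}"

text \<open>The library order on \<open>real ^ 'm\<close> is the componentwise one.\<close>

definition efficient :: "(real ^ 'm) set \<Rightarrow> (real ^ 'm) set" where
  "efficient X = {x \<in> X. \<forall>y\<in>X. y \<ge> x \<longrightarrow> y = x}"

function white_set ::
  "nat \<Rightarrow> 's set \<Rightarrow> ('s \<Rightarrow> 'a set) \<Rightarrow> (nat \<Rightarrow> 's \<Rightarrow> 'a \<Rightarrow> real ^ 'm) \<Rightarrow> ('s \<Rightarrow> real ^ 'm) \<Rightarrow>
   (nat \<Rightarrow> 's \<Rightarrow> 's \<Rightarrow> 'a \<Rightarrow> real) \<Rightarrow> nat \<Rightarrow> 's \<Rightarrow> (real ^ 'm) set"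
where
  "white_set N S A R RN p t s =
     (if t < N
      then efficient {R t s a + (\<Sum>j\<in>S. p t j s a *\<^sub>R v j) | a v.
             a \<in> A s \<and> (\<forall>j\<in>S. v j \<in> white_set N S A R RN p (Suc t) j)}
      else {RN s})"
  by auto
termination
  by (relation "Wellfounded.measure (\<lambda>(N, S, A, R, RN, p, t, s). N - t)") auto

declare total_reward.simps [simp del] white_set.simps [simp del]

end

(* External stability carries the proof: every point of a compact set of real vectors lies below
   an efficient point, since the coordinate sum attains its maximum above it. The attainable rewards
   at a history are obtained from those at its one-step extensions by the same one-step operator as
   in White's equations, because policies chosen separately for each next state can be glued to a
   single history-dependent policy. This operator is monotone, as transition probabilities are
   nonnegative, and preserves compactness; hence restricting its argument to efficient points does
   not change the efficient points of its value, and backward induction applies. *)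

theory Submission
  imports Defs
begin

section \<open>Efficient points and external stability\<close>

lemma efficient_singleton [simp]: "efficient {x} = {x}"
  by (auto simp: efficient_def)

lemma efficient_subset: "efficient X \<subseteq> X"
  by (auto simp: efficient_def)

lemma efficient_dominates:
  fixes X :: "(real ^ 'm) set"
  assumes "compact X" "x \<in> X"
  obtains y where "y \<in> efficient X" "x \<le> y"
proof -
  \<comment> \<open>Maximizing only over the points of \<open>X\<close> above \<open>x\<close>
    ensures that the maximizer dominates \<open>x\<close>.\<close>
  have "compact (X \<inter> {x..})"
    using assms(1) closed_eucl_atLeast by (rule compact_Int_closed)
  moreover have "X \<inter> {x..} \<noteq> {}"
    using assms(2) by auto
  moreover have "continuous_on (X \<inter> {x..}) (\<lambda>y. \<Sum>i\<in>UNIV. y $ i)"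
    by (intro continuous_intros)
  ultimately obtain y where y: "y \<in> X" "x \<le> y"
    and max: "\<And>z. z \<in> X \<Longrightarrow> x \<le> z \<Longrightarrow> (\<Sum>i\<in>UNIV. z $ i) \<le> (\<Sum>i\<in>UNIV. y $ i)"
    using continuous_attains_sup[of "X \<inter> {x..}" "\<lambda>y. \<Sum>i\<in>UNIV. y $ i"] by auto
  have "z = y" if "z \<in> X" "y \<le> z" for z
  proof (rule ccontr)
    assume "z \<noteq> y"
    then obtain i where "z $ i \<noteq> y $ i"
      by (auto simp: vec_eq_iff)
    with \<open>y \<le> z\<close> have "y $ i < z $ i"
      by (metis less_eq_vec_def less_eq_real_def)
    then have "(\<Sum>i\<in>UNIV. y $ i) < (\<Sum>i\<in>UNIV. z $ i)"
      using \<open>y \<le> z\<close> by (intro sum_strict_mono_ex1) (auto simp: less_eq_vec_def)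
    \<comment> \<open>By transitivity \<open>z\<close> is above \<open>x\<close> as well, so it
      competes with \<open>y\<close> in the maximization.\<close>
    moreover have "(\<Sum>i\<in>UNIV. z $ i) \<le> (\<Sum>i\<in>UNIV. y $ i)"
      using max that y(2) by force
    ultimately show False by simp
  qed
  then have "y \<in> efficient X"
    using y by (auto simp: efficient_def)
  with y(2) that show thesis by blast
qed

text \<open>An efficient point of \<open>X\<close> equals any point of \<open>Y\<close> above it,
  hence lies in \<open>Y\<close>. Conversely, if some \<open>z\<close> in \<open>X\<close> is above
  an efficient point \<open>x\<close> of \<open>Y\<close>, then a point of \<open>Y\<close> above
  \<open>z\<close> must be \<open>x\<close> itself, and antisymmetry gives
  \<open>z = x\<close>.\<close>

lemma efficient_eq_if_dominated:
  assumes "Y \<subseteq> X" "\<And>x. x \<in> X \<Longrightarrow> \<exists>y\<in>Y. x \<le> y"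
  shows "efficient Y = efficient X"
proof
  show "efficient X \<subseteq> efficient Y"
    using assms unfolding efficient_def by blast
  show "efficient Y \<subseteq> efficient X"
  proof
    fix x assume x: "x \<in> efficient Y"
    have "z = x" if z: "z \<in> X" "x \<le> z" for z
    proof -
      obtain y where y: "y \<in> Y" "z \<le> y"
        using assms(2) z(1) by blast
      then have "y = x"
        using x z(2) by (auto simp: efficient_def)
      with y(2) z(2) show ?thesis by simp
    qed
    with x assms(1) show "x \<in> efficient X"
      by (auto simp: efficient_def)
  qed
qed

section \<open>The one-step operator, shared by both recursions at a fixed epoch and state\<close>

definition one_step_rewards ::
  "'s set \<Rightarrow> 'a set \<Rightarrow> ('a \<Rightarrow> real ^ 'm) \<Rightarrow> ('s \<Rightarrow> 'a \<Rightarrow> real) \<Rightarrow> ('s \<Rightarrow> (real ^ 'm) set) \<Rightarrow> (real ^ 'm) set"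
where
  "one_step_rewards S B r q V =
     {r a + (\<Sum>j\<in>S. q j a *\<^sub>R v j) | a v. a \<in> B \<and> (\<forall>j\<in>S. v j \<in> V j)}"

lemma one_step_rewardsI:
  assumes "x = r a + (\<Sum>j\<in>S. q j a *\<^sub>R v j)" "a \<in> B" "\<And>j. j \<in> S \<Longrightarrow> v j \<in> V j"
  shows "x \<in> one_step_rewards S B r q V"
  using assms unfolding one_step_rewards_def by blast

lemma one_step_rewards_mono:
  assumes "\<And>j. j \<in> S \<Longrightarrow> V j \<subseteq> W j"
  shows "one_step_rewards S B r q V \<subseteq> one_step_rewards S B r q W"
  using assms unfolding one_step_rewards_def by blast

lemma one_step_rewards_cong:
  assumes "\<And>j. j \<in> S \<Longrightarrow> V j = W j"
  shows "one_step_rewards S B r q V = one_step_rewards S B r q W"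
  using assms by (intro equalityI one_step_rewards_mono) auto

text \<open>Tychonoff's theorem: filling the coordinates outside \<open>I\<close> with the compact
  set \<open>{undefined}\<close> turns the extensional product into a product over the whole index
  type, whose topology is that of the function type.\<close>

lemma compact_PiE:
  fixes V :: "'i \<Rightarrow> 'b::topological_space set"
  assumes "\<And>i. i \<in> I \<Longrightarrow> compact (V i)"
  shows "compact (Pi\<^sub>E I V)"
proof -
  have "Pi\<^sub>E I V = Pi\<^sub>E UNIV (\<lambda>i. if i \<in> I then V i else {undefined})"
    by (auto simp: PiE_iff extensional_def split: if_splits)
  moreover have "compactin (product_topology (\<lambda>i. euclidean) UNIV)
      (Pi\<^sub>E UNIV (\<lambda>i. if i \<in> I then V i else {undefined}))"
    using assms by (auto simp: compactin_PiE)
  ultimately show ?thesis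
    by (simp add: euclidean_product_topology)
qed

lemma compact_one_step_rewards:
  fixes B :: "'a::topological_space set" and r :: "'a \<Rightarrow> real ^ 'm"
  assumes "compact B" "continuous_on B r" "\<And>j. j \<in> S \<Longrightarrow> continuous_on B (q j)"
    and "\<And>j. j \<in> S \<Longrightarrow> compact (V j)"
  shows "compact (one_step_rewards S B r q V)"
proof -
  let ?f = "\<lambda>(a, v). r a + (\<Sum>j\<in>S. q j a *\<^sub>R v j)"
  have "one_step_rewards S B r q V = ?f ` (B \<times> Pi\<^sub>E S V)"
  proof
    show "one_step_rewards S B r q V \<subseteq> ?f ` (B \<times> Pi\<^sub>E S V)"
    proof
      fix x assume "x \<in> one_step_rewards S B r q V"
      then obtain a v where "x = r a + (\<Sum>j\<in>S. q j a *\<^sub>R v j)" "a \<in> B" "\<forall>j\<in>S. v j \<in> V j"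
        by (auto simp: one_step_rewards_def)
      \<comment> \<open>The choice \<open>v\<close> is arbitrary outside \<open>S\<close>;
        restricting it makes it extensional and leaves the sum unchanged.\<close>
      then show "x \<in> ?f ` (B \<times> Pi\<^sub>E S V)"
        by (intro image_eqI[of _ _ "(a, restrict v S)"]) auto
    qed
  qed (fastforce simp: one_step_rewards_def)
  moreover have "continuous_on (B \<times> Pi\<^sub>E S V) (\<lambda>x. r (fst x) + (\<Sum>j\<in>S. q j (fst x) *\<^sub>R snd x j))"
    by (intro continuous_intros continuous_on_compose2[OF assms(2)]
          continuous_on_compose2[OF assms(3)] continuous_on_compose2[OF continuous_on_product_coordinates])
      auto
  ultimately show ?thesis
    using assms(1,4) by (simp add: compact_continuous_image compact_Times compact_PiE case_prod_unfold)
qed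

lemma one_step_rewards_dominated:
  assumes nonneg: "\<And>j a. j \<in> S \<Longrightarrow> a \<in> B \<Longrightarrow> 0 \<le> q j a"
    and dominates: "\<And>j x. j \<in> S \<Longrightarrow> x \<in> V j \<Longrightarrow> \<exists>y\<in>W j. x \<le> y"
    and x: "x \<in> one_step_rewards S B r q V"
  obtains y where "y \<in> one_step_rewards S B r q W" "x \<le> y"
proof -
  obtain a v where a: "a \<in> B" and v: "\<forall>j\<in>S. v j \<in> V j"
    and x_eq: "x = r a + (\<Sum>j\<in>S. q j a *\<^sub>R v j)"
    using x by (auto simp: one_step_rewards_def)
  have "\<forall>j\<in>S. \<exists>y. y \<in> W j \<and> v j \<le> y"
    using dominates v by blast
  then obtain w where w: "\<And>j. j \<in> S \<Longrightarrow> w j \<in> W j \<and> v j \<le> w j"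
    by metis
  have "x \<le> r a + (\<Sum>j\<in>S. q j a *\<^sub>R w j)"
    unfolding x_eq using nonneg a w
    by (auto simp: less_eq_vec_def sum_component intro!: sum_mono mult_left_mono)
  moreover have "r a + (\<Sum>j\<in>S. q j a *\<^sub>R w j) \<in> one_step_rewards S B r q W"
    using a w by (intro one_step_rewardsI) auto
  ultimately show thesis using that by blast
qed

text \<open>Compactness gives external stability of each \<open>V j\<close>, and nonnegative weights
  carry the domination through the operator. This is what permits discarding dominated continuations
  before the one-step operator is applied.\<close>

lemma efficient_one_step_rewards_efficient:
  assumes "\<And>j a. j \<in> S \<Longrightarrow> a \<in> B \<Longrightarrow> 0 \<le> q j a"
    and "\<And>j. j \<in> S \<Longrightarrow> compact (V j)"
  shows "efficient (one_step_rewards S B r q (\<lambda>j. efficient (V j))) =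
    efficient (one_step_rewards S B r q V)"
proof (rule efficient_eq_if_dominated)
  fix x assume x: "x \<in> one_step_rewards S B r q V"
  have "\<exists>y\<in>efficient (V j). z \<le> y" if "j \<in> S" "z \<in> V j" for j z
    using assms(2) that efficient_dominates by metis
  then show "\<exists>y\<in>one_step_rewards S B r q (\<lambda>j. efficient (V j)). x \<le> y"
    using one_step_rewards_dominated[OF assms(1) _ x] by metis
qed (simp add: efficient_subset one_step_rewards_mono)

section \<open>Histories, policies and the recursion for attainable rewards\<close>

lemma snoc_mem_histories:
  "h \<in> histories S t \<Longrightarrow> j \<in> S \<Longrightarrow> h @ [j] \<in> histories S (Suc t)"
  by (auto simp: histories_def)

lemma last_mem_of_histories:
  "h \<in> histories S t \<Longrightarrow> 1 \<le> t \<Longrightarrow> last h \<in> S"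
  by (cases h rule: rev_cases) (auto simp: histories_def)

lemma policies_iff:
  "\<pi> \<in> policies N S A \<longleftrightarrow>
     (\<forall>t\<in>{1..<N}. (\<forall>h\<in>histories S t. \<pi> t h \<in> A (last h)) \<and> (\<forall>h. h \<notin> histories S t \<longrightarrow> \<pi> t h = undefined)) \<and>
     (\<forall>t. t \<notin> {1..<N} \<longrightarrow> \<pi> t = undefined)"
  unfolding policies_def decision_rules_def PiE_iff extensional_def by blast

lemma restrict_mem_policies:
  assumes "\<And>t h. t \<in> {1..<N} \<Longrightarrow> h \<in> histories S t \<Longrightarrow> \<pi> t h \<in> A (last h)"
  shows "(\<lambda>t\<in>{1..<N}. restrict (\<pi> t) (histories S t)) \<in> policies N S A"
  using assms unfolding policies_def decision_rules_def
  by (intro restrict_PiE_iff[THEN iffD2] ballI) (auto simp: restrict_PiE_iff)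

text \<open>Without a policy the attainable set at the terminal epoch would be empty instead of a
  singleton.\<close>

lemma policies_nonempty:
  assumes "\<And>s. s \<in> S \<Longrightarrow> A s \<noteq> {}"
  shows "policies N S A \<noteq> {}"
proof -
  have "(\<lambda>t\<in>{1..<N}. \<lambda>h\<in>histories S t. SOME a. a \<in> A (last h)) \<in> policies N S A"
    using assms last_mem_of_histories by (intro restrict_mem_policies) (force simp: some_in_eq)
  then show ?thesis by blast
qed

text \<open>The recursion started at \<open>h\<close> consults a policy only at \<open>h\<close> and
  its extensions, which are the histories \<open>h'\<close> with \<open>take t h' = h\<close>
  because \<open>h\<close> has length \<open>t\<close>.\<close>

lemma total_reward_cong:
  assumes "h \<in> histories S t"
    and "\<And>t' h'. t \<le> t' \<Longrightarrow> t' < N \<Longrightarrow> h' \<in> histories S t' \<Longrightarrow> take t h' = h \<Longrightarrow> \<pi> t' h' = \<pi>' t' h'"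
  shows "total_reward N S R RN p \<pi> t h = total_reward N S R RN p \<pi>' t h"
  using assms
proof (induction "N - t" arbitrary: t h)
  case 0
  then show ?case by (simp add: total_reward.simps)
next
  case (Suc n)
  have "total_reward N S R RN p \<pi> (Suc t) (h @ [j]) = total_reward N S R RN p \<pi>' (Suc t) (h @ [j])"
    if "j \<in> S" for j
  proof (rule Suc.hyps(1))
    show "h @ [j] \<in> histories S (Suc t)"
      using Suc.prems(1) that by (rule snoc_mem_histories)
    fix t' h' assume *: "Suc t \<le> t'" "t' < N" "h' \<in> histories S t'" "take (Suc t) h' = h @ [j]"
    \<comment> \<open>Extensions of \<open>h @ [j]\<close> also extend \<open>h\<close>, so
      agreement of the policies passes to the next epoch.\<close>
    have "take t h' = take t (take (Suc t) h')" by simp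
    also have "\<dots> = h" using * Suc.prems(1) by (simp add: histories_def)
    finally show "\<pi> t' h' = \<pi>' t' h'"
      using * Suc.prems(2) by simp
  qed (use Suc.hyps(2) in simp)
  moreover have "\<pi> t h = \<pi>' t h"
    using Suc by (auto simp: histories_def)
  ultimately show ?case
    by (simp add: total_reward.simps[of N _ _ _ _ _ t])
qed

text \<open>One inclusion unfolds a policy once. For the other, the histories extending
  \<open>h @ [j]\<close> for distinct \<open>j\<close> are disjoint and none is \<open>h\<close>, so
  an action at \<open>h\<close> and a separate policy for each \<open>j\<close> never
  conflict.\<close>

lemma attainable_rewards_step:
  assumes t: "t \<in> {1..<N}" and h: "h \<in> histories S t"
  shows "attainable_rewards N S A R RN p t h =
    one_step_rewards S (A (last h)) (R t (last h)) (\<lambda>j. p t j (last h))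
      (\<lambda>j. attainable_rewards N S A R RN p (Suc t) (h @ [j]))"
    (is "?L = ?R")
proof
  show "?L \<subseteq> ?R"
  proof
    fix x assume "x \<in> ?L"
    then obtain \<pi> where \<pi>: "\<pi> \<in> policies N S A" and x: "x = total_reward N S R RN p \<pi> t h"
      by (auto simp: attainable_rewards_def)
    have "\<pi> t h \<in> A (last h)"
      using \<pi> t h by (auto simp: policies_iff)
    moreover have "x = R t (last h) (\<pi> t h)
        + (\<Sum>j\<in>S. p t j (last h) (\<pi> t h) *\<^sub>R total_reward N S R RN p \<pi> (Suc t) (h @ [j]))"
      using x t by (simp add: total_reward.simps[of N _ _ _ _ _ t])
    moreover have "total_reward N S R RN p \<pi> (Suc t) (h @ [j])
        \<in> attainable_rewards N S A R RN p (Suc t) (h @ [j])" for j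
      using \<pi> by (auto simp: attainable_rewards_def)
    ultimately show "x \<in> ?R"
      by (intro one_step_rewardsI)
  qed
  show "?R \<subseteq> ?L"
  proof
    fix x assume "x \<in> ?R"
    then obtain a v where a: "a \<in> A (last h)"
      and v: "\<forall>j\<in>S. v j \<in> attainable_rewards N S A R RN p (Suc t) (h @ [j])"
      and x: "x = R t (last h) a + (\<Sum>j\<in>S. p t j (last h) a *\<^sub>R v j)"
      by (auto simp: one_step_rewards_def)
    have "\<forall>j\<in>S. \<exists>\<pi>. \<pi> \<in> policies N S A \<and> v j = total_reward N S R RN p \<pi> (Suc t) (h @ [j])"
      using v by (auto simp: attainable_rewards_def)
    then obtain \<pi> where \<pi>: "\<And>j. j \<in> S \<Longrightarrow> \<pi> j \<in> policies N S A"
      and v_eq: "\<And>j. j \<in> S \<Longrightarrow> v j = total_reward N S R RN p (\<pi> j) (Suc t) (h @ [j])"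
      by metis
    (* The (t+1)-st state selects the policy to follow. Shorter histories are left whole by take;
       for them any choice of a state in S will do. *)
    define \<sigma> where "\<sigma> = (\<lambda>t' h'. if h' = h then a else \<pi> (last (take (Suc t) h')) t' h')"
    define \<rho> where "\<rho> = (\<lambda>t'\<in>{1..<N}. restrict (\<sigma> t') (histories S t'))"
    have "\<rho> \<in> policies N S A"
      unfolding \<rho>_def
    proof (rule restrict_mem_policies)
      fix t' h' assume *: "t' \<in> {1..<N}" "h' \<in> histories S t'"
      \<comment> \<open>Both \<open>t'\<close> and \<open>Suc t\<close> are at least 1, so the
        truncation is nonempty and its last entry is a state that indexes one of the chosen
        policies.\<close>
      then have "take (Suc t) h' \<in> histories S (min t' (Suc t))"
        by (auto simp: histories_def dest: in_set_takeD)
      then have "last (take (Suc t) h') \<in> S"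
        using * by (intro last_mem_of_histories) auto
      then show "\<sigma> t' h' \<in> A (last h')"
        using * a \<pi> by (auto simp: \<sigma>_def policies_iff)
    qed
    moreover have "x = total_reward N S R RN p \<rho> t h"
    proof -
      \<comment> \<open>Every extension of \<open>h @ [j]\<close> is longer than \<open>h\<close>
        and has \<open>j\<close> in position \<open>Suc t\<close>, so there the glued policy follows
        \<open>\<pi> j\<close>.\<close>
      have "v j = total_reward N S R RN p \<rho> (Suc t) (h @ [j])" if "j \<in> S" for j
        unfolding v_eq[OF that]
        using that h t by (intro total_reward_cong snoc_mem_histories)
          (auto simp: \<rho>_def \<sigma>_def histories_def)
      moreover have "\<rho> t h = a"
        using t h by (simp add: \<rho>_def \<sigma>_def)
      ultimately show ?thesis
        using x t by (simp add: total_reward.simps[of N _ _ _ _ _ t])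
    qed
    ultimately show "x \<in> ?L"
      by (auto simp: attainable_rewards_def)
  qed
qed

section \<open>Backward induction over the epochs\<close>

theorem theorem5:
  fixes N :: nat
    and S :: "'s set"
    and A :: "'s \<Rightarrow> 'a::topological_space set"
    and R :: "nat \<Rightarrow> 's \<Rightarrow> 'a \<Rightarrow> real ^ 'm"
    and RN :: "'s \<Rightarrow> real ^ 'm"
    and p :: "nat \<Rightarrow> 's \<Rightarrow> 's \<Rightarrow> 'a \<Rightarrow> real"
  assumes "N > 2"
    and "finite S"
    and "\<And>s. s \<in> S \<Longrightarrow> A s \<noteq> {}"
    and "\<And>s. s \<in> S \<Longrightarrow> compact (A s)"
    and "\<And>t s i. t \<in> {1..<N} \<Longrightarrow> s \<in> S \<Longrightarrow> continuous_on (A s) (\<lambda>a. R t s a $ i)"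
    and "\<And>t j s. t \<in> {1..<N} \<Longrightarrow> j \<in> S \<Longrightarrow> s \<in> S \<Longrightarrow> continuous_on (A s) (\<lambda>a. p t j s a)"
    and "\<And>t j s a. t \<in> {1..<N} \<Longrightarrow> j \<in> S \<Longrightarrow> s \<in> S \<Longrightarrow> a \<in> A s \<Longrightarrow> p t j s a \<ge> 0"
    and "\<And>t s a. t \<in> {1..<N} \<Longrightarrow> s \<in> S \<Longrightarrow> a \<in> A s \<Longrightarrow> (\<Sum>j\<in>S. p t j s a) = 1"
    and "\<And>t. t \<in> {1..<N} \<Longrightarrow> compact (decision_rules S A t)"
  shows "\<forall>t\<in>{1..N}. \<forall>h\<in>histories S t.
           white_set N S A R RN p t (last h) = efficient (attainable_rewards N S A R RN p t h)"
proof (intro ballI)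
  let ?V = "attainable_rewards N S A R RN p"
  let ?U = "white_set N S A R RN p"
  \<comment> \<open>Compactness is carried along in the induction because the step needs external
    stability of the attainable sets at the next epoch.\<close>
  have "compact (?V t h) \<and> ?U t (last h) = efficient (?V t h)"
    if "t \<in> {1..N}" "h \<in> histories S t" for t h
    using that
  proof (induction "N - t" arbitrary: t h)
    case 0
    then have "?V t h = {RN (last h)}"
      using policies_nonempty[of S A N] assms(3)
      by (auto simp: attainable_rewards_def total_reward.simps)
    then show ?case
      using 0 by (simp add: white_set.simps)
  next
    case (Suc n)
    let ?s = "last h"
    have t: "t \<in> {1..<N}" and s: "?s \<in> S"
      using Suc last_mem_of_histories by auto
    \<comment> \<open>As \<open>h @ [j]\<close> ends in \<open>j\<close>, the efficient attainable
      set after it is White's set at \<open>j\<close>, whatever \<open>h\<close> is.\<close>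
    have IH: "compact (?V (Suc t) (h @ [j]))" "?U (Suc t) j = efficient (?V (Suc t) (h @ [j]))"
      if "j \<in> S" for j
      using Suc.hyps(1)[of "Suc t" "h @ [j]"] Suc.hyps(2) t snoc_mem_histories[OF Suc.prems(2) that]
      by auto
    have V: "?V t h = one_step_rewards S (A ?s) (R t ?s) (\<lambda>j. p t j ?s) (\<lambda>j. ?V (Suc t) (h @ [j]))"
      using attainable_rewards_step t Suc.prems by blast
    \<comment> \<open>Continuity is assumed componentwise and is assembled here into continuity of
      the vector reward.\<close>
    have "continuous_on (A ?s) (R t ?s)"
      using continuous_on_vec_lambda[of "A ?s" "\<lambda>i a. R t ?s a $ i"] assms(5)[OF t s] by simp
    then have compact: "compact (?V t h)"
      unfolding V using assms(4,6) IH(1) s t by (intro compact_one_step_rewards) auto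
    have "?U t ?s = efficient (one_step_rewards S (A ?s) (R t ?s) (\<lambda>j. p t j ?s) (?U (Suc t)))"
      using t by (simp add: white_set.simps[of N _ _ _ _ _ t] one_step_rewards_def)
    also have "\<dots> = efficient (one_step_rewards S (A ?s) (R t ?s) (\<lambda>j. p t j ?s)
        (\<lambda>j. efficient (?V (Suc t) (h @ [j]))))"
      using IH(2) by (intro arg_cong[of _ _ efficient] one_step_rewards_cong)
    also have "\<dots> = efficient (?V t h)"
      unfolding V using IH(1) assms(7) s t by (intro efficient_one_step_rewards_efficient)
    finally show ?case
      using compact by simp
  qed
  then show "?U t (last h) = efficient (?V t h)" if "t \<in> {1..N}" "h \<in> histories S t" for t h
    using that by blast
qed

end
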